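(* For every smooth complex projective non-hyperelliptic curve $C$ of genus $g\ge4$: (1) $\ker(\mu_{6g-6})=0$, hence $\mu_{2k}\equiv0$ for all $k>3g-3$. (2) For all $0\le l\le 3g-3$, $\dim\left(\ker(\mu_{6g-6-2(l+1)})\right)\le(l+1)^2$, hence $\operatorname{rank}(\mu_{6g-6-2l})\le(l+1)^2$.
   Context: Let $C$ be a smooth complex projective curve of genus $g$ with canonical bundle $\omega_C$, and let $\omega_1,\dots,\omega_g$ be a basis of $H^0(C,\omega_C)$, locally $\omega_i=f_i(z)\,dz$. Let $\mu_0:\mathrm{Sym}^2H^0(C,\omega_C)\to H^0(C,\omega_C^{\otimes2})$ be the multiplication map and $I_2(\omega_C):=\ker(\mu_0)$. Inductively, for $k\ge1$, the even Gaussian map $\mu_{2k}:\ker(\mu_{2k-2})\to H^0(C,\omega_C^{\otimes(2k+2)})$ of the canonical bundle is given, for $Q=\sum_{i,j}a_{ij}\,\omega_i\otimes\omega_j$ with $a_{ij}=a_{ji}$, by $\mu_{2k}(Q)=\left(\sum_{i,j}a_{ij}f_i^{(2k)}(z)f_j(z)\right)dz^{2k+2}$. Convention: $\ker(\mu_{-2}):=\mathrm{Sym}^2H^0(C,\omega_C)$, the domain of $\mu_0$. *)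

theory Defs
  imports "HOL-Complex_Analysis.Complex_Analysis" "HOL-Library.Function_Algebras"
begin

section \<open>Smooth complex projective curves\<close>

text \<open>A point of projective space is a line through the origin of \<open>complex ^ 'n\<close>, so the
  projective space has dimension \<open>CARD('n) - 1\<close>. It carries the classical (quotient) topology.\<close>

type_synonym 'n pt = "(complex ^ 'n) set"

definition proj_space :: "'n::finite pt set" where
  "proj_space = {vec.span {v} | v. v \<noteq> 0}"

definition proj_top :: "'n::finite pt topology" where
  "proj_top = topology (\<lambda>U. U \<subseteq> proj_space \<and> open {v. v \<noteq> 0 \<and> vec.span {v} \<in> U})"

lemma openin_proj_top:
  fixes U :: "'n::finite pt set"
  shows "openin proj_top U \<longleftrightarrow> U \<subseteq> proj_space \<and> open {v. v \<noteq> 0 \<and> vec.span {v} \<in> U}"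
proof -
  have int: "{v :: complex ^ 'n. v \<noteq> 0 \<and> vec.span {v} \<in> S \<inter> T} =
      {v. v \<noteq> 0 \<and> vec.span {v} \<in> S} \<inter> {v. v \<noteq> 0 \<and> vec.span {v} \<in> T}" for S T
    by auto
  have un: "{v :: complex ^ 'n. v \<noteq> 0 \<and> vec.span {v} \<in> \<Union>K} =
      (\<Union>S\<in>K. {v. v \<noteq> 0 \<and> vec.span {v} \<in> S})" for K
    by auto
  have "istopology (\<lambda>U :: 'n pt set. U \<subseteq> proj_space \<and> open {v. v \<noteq> 0 \<and> vec.span {v} \<in> U})"
    unfolding istopology_def int un by blast
  then show ?thesis
    unfolding proj_top_def by (simp add: topology_inverse')
qed

lemma topspace_proj_top: "topspace proj_top = (proj_space :: 'n::finite pt set)"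
proof
  show "topspace proj_top \<subseteq> (proj_space :: 'n pt set)"
    by (meson openin_proj_top openin_topspace)
  have "{v :: complex ^ 'n. v \<noteq> 0 \<and> vec.span {v} \<in> proj_space} = - {0}"
    by (auto simp: proj_space_def)
  then have "openin proj_top (proj_space :: 'n pt set)"
    by (simp add: openin_proj_top open_Compl)
  then show "(proj_space :: 'n pt set) \<subseteq> topspace proj_top"
    by (rule openin_subset)
qed

text \<open>Over the complex numbers polynomials are identified with polynomial functions;
  \<open>\<alpha>\<close> ranges over the multi-indices of total degree \<open>d\<close>.\<close>

definition homogeneous_poly :: "nat \<Rightarrow> (complex ^ 'n::finite \<Rightarrow> complex) \<Rightarrow> bool" where
  "homogeneous_poly d F \<longleftrightarrow>
     (\<exists>c. \<forall>x. F x = (\<Sum>\<alpha> | (\<Sum>i\<in>UNIV. \<alpha> i) = d. c \<alpha> * (\<Prod>i\<in>UNIV. x $ i ^ \<alpha> i)))"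

definition projective_algebraic_set :: "'n::finite pt set \<Rightarrow> bool" where
  "projective_algebraic_set C \<longleftrightarrow>
     (\<exists>S. (\<forall>F\<in>S. \<exists>d. homogeneous_poly d F) \<and>
          C = {vec.span {v} | v. v \<noteq> 0 \<and> (\<forall>F\<in>S. F v = 0)})"

text \<open>\<open>\<Psi>\<close> gives homogeneous coordinates of \<open>\<psi>\<close>, holomorphic on \<open>W\<close>.\<close>

definition holomorphic_lift ::
    "complex set \<Rightarrow> (complex \<Rightarrow> complex ^ 'n::finite) \<Rightarrow> (complex \<Rightarrow> 'n pt) \<Rightarrow> bool" where
  "holomorphic_lift W \<Psi> \<psi> \<longleftrightarrow>
     open W \<and> (\<forall>i. (\<lambda>t. \<Psi> t $ i) holomorphic_on W) \<and>
     (\<forall>t\<in>W. \<Psi> t \<noteq> 0 \<and> \<psi> t = vec.span {\<Psi> t})"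

definition proj_holomorphic_on :: "(complex \<Rightarrow> 'n::finite pt) \<Rightarrow> complex set \<Rightarrow> bool" where
  "proj_holomorphic_on \<psi> D \<longleftrightarrow>
     (\<forall>t\<in>D. \<exists>W \<Psi>. t \<in> W \<and> W \<subseteq> D \<and> holomorphic_lift W \<Psi> \<psi>)"

text \<open>The differential of \<open>\<psi> = [\<Psi>]\<close> at \<open>t\<close> is nonzero iff \<open>\<Psi> t\<close> and \<open>\<Psi>' t\<close> are linearly
  independent; this does not depend on the lift.\<close>

definition proj_immersion_on :: "(complex \<Rightarrow> 'n::finite pt) \<Rightarrow> complex set \<Rightarrow> bool" where
  "proj_immersion_on \<psi> D \<longleftrightarrow>
     (\<forall>t\<in>D. \<exists>W \<Psi>. t \<in> W \<and> W \<subseteq> D \<and> holomorphic_lift W \<Psi> \<psi> \<and>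
        (\<chi> i. deriv (\<lambda>s. \<Psi> s $ i) t) \<notin> vec.span {\<Psi> t})"

text \<open>A local coordinate \<open>z\<close> on an open subset \<open>U\<close> of \<open>C\<close>, whose inverse is a holomorphic
  immersion into projective space.\<close>

type_synonym 'n coord = "'n pt set \<times> ('n pt \<Rightarrow> complex)"

definition local_coord :: "'n::finite pt set \<Rightarrow> 'n coord \<Rightarrow> bool" where
  "local_coord C = (\<lambda>(U, z).
     openin (subtopology proj_top C) U \<and> open (z ` U) \<and>
     homeomorphic_map (subtopology proj_top U) (top_of_set (z ` U)) z \<and>
     proj_immersion_on (inv_into U z) (z ` U))"

text \<open>Smoothness is being a one-dimensional complex submanifold of projective space near every
  point. As the curve is smooth, its irreducibility amounts to its being connected.\<close>

definition smooth_projective_curve :: "'n::finite pt set \<Rightarrow> bool" where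
  "smooth_projective_curve C \<longleftrightarrow>
     projective_algebraic_set C \<and> C \<noteq> {} \<and> connectedin proj_top C \<and>
     (\<forall>p\<in>C. \<exists>U z. local_coord C (U, z) \<and> p \<in> U)"


section \<open>Holomorphic differentials\<close>

text \<open>Complex vector spaces of functions of two arguments, with pointwise operations.\<close>

definition fscale :: "complex \<Rightarrow> ('a \<Rightarrow> 'b \<Rightarrow> complex) \<Rightarrow> 'a \<Rightarrow> 'b \<Rightarrow> complex" where
  "fscale c f = (\<lambda>x y. c * f x y)"

global_interpretation fvec: vector_space fscale
  by unfold_locales (auto simp: fscale_def algebra_simps fun_eq_iff)

text \<open>A differential is the family of its local coefficients: \<open>f (U, z)\<close> is the function with
  \<open>\<omega> = f (U, z) dz\<close> on \<open>U\<close>, as a function of the value of the coordinate. To make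
  the representation unique, coefficients are \<open>0\<close> where they have no meaning.\<close>

type_synonym 'n form = "'n coord \<Rightarrow> complex \<Rightarrow> complex"

definition holomorphic_forms :: "'n::finite pt set \<Rightarrow> 'n form set" where
  "holomorphic_forms C = {f.
     (\<forall>U z. local_coord C (U, z) \<longrightarrow> f (U, z) holomorphic_on z ` U) \<and>
     (\<forall>U z V w p. local_coord C (U, z) \<longrightarrow> local_coord C (V, w) \<longrightarrow> p \<in> U \<inter> V \<longrightarrow>
        f (U, z) (z p) = f (V, w) (w p) * deriv (w \<circ> inv_into U z) (z p)) \<and>
     (\<forall>U z t. \<not> (local_coord C (U, z) \<and> t \<in> z ` U) \<longrightarrow> f (U, z) t = 0)}"

definition genus :: "'n::finite pt set \<Rightarrow> nat" where
  "genus C = fvec.dim (holomorphic_forms C)"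

definition basis_of_forms :: "'n::finite pt set \<Rightarrow> nat \<Rightarrow> (nat \<Rightarrow> 'n form) \<Rightarrow> bool" where
  "basis_of_forms C g \<omega> \<longleftrightarrow>
     inj_on \<omega> {..<g} \<and> fvec.independent (\<omega> ` {..<g}) \<and>
     fvec.span (\<omega> ` {..<g}) = holomorphic_forms C"

text \<open>Hyperelliptic (for genus at least two): there is a morphism of degree two onto the projective
  line. The degree is the number of points of a general fibre.\<close>

definition hyperelliptic :: "'n::finite pt set \<Rightarrow> bool" where
  "hyperelliptic C \<longleftrightarrow>
     (\<exists>h :: 'n pt \<Rightarrow> 2 pt.
        (\<forall>U z. local_coord C (U, z) \<longrightarrow> proj_holomorphic_on (h \<circ> inv_into U z) (z ` U)) \<and>
        finite {q \<in> proj_space. card {p \<in> C. h p = q} \<noteq> 2})"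


section \<open>Even Gaussian maps of the canonical bundle\<close>

text \<open>With respect to a basis \<open>\<omega> 0, \<dots>, \<omega> (g - 1)\<close> of the holomorphic differentials, the element
  \<open>\<Sum>i j. a i j (\<omega> i \<otimes> \<omega> j)\<close> of the symmetric square is given by its symmetric coefficient
  matrix \<open>a\<close> (extended by \<open>0\<close>).\<close>

definition sym2 :: "nat \<Rightarrow> (nat \<Rightarrow> nat \<Rightarrow> complex) set" where
  "sym2 g = {a. (\<forall>i j. a i j = a j i) \<and> (\<forall>i j. \<not> (i < g \<and> j < g) \<longrightarrow> a i j = 0)}"

text \<open>The map \<open>\<mu>\<^sub>m\<close> for even \<open>m\<close>. Its value is the family of the coefficients of \<open>dz ^ (m + 2)\<close>
  with respect to all local coordinates \<open>z\<close>.\<close>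

definition gauss_map ::
    "'n::finite pt set \<Rightarrow> nat \<Rightarrow> (nat \<Rightarrow> 'n form) \<Rightarrow> nat \<Rightarrow> (nat \<Rightarrow> nat \<Rightarrow> complex) \<Rightarrow>
     'n coord \<Rightarrow> complex \<Rightarrow> complex" where
  "gauss_map C g \<omega> m a = (\<lambda>(U, z) t.
     if local_coord C (U, z) \<and> t \<in> z ` U
     then \<Sum>i<g. \<Sum>j<g. a i j * (deriv ^^ m) (\<omega> i (U, z)) t * \<omega> j (U, z) t
     else 0)"

text \<open>\<open>gauss_dom C g \<omega> k\<close> is the domain of \<open>\<mu>\<^sub>2\<^sub>k\<close>, that is, the kernel of \<open>\<mu>\<^sub>2\<^sub>k\<^sub>-\<^sub>2\<close>.\<close>

primrec gauss_dom ::
    "'n::finite pt set \<Rightarrow> nat \<Rightarrow> (nat \<Rightarrow> 'n form) \<Rightarrow> nat \<Rightarrow> (nat \<Rightarrow> nat \<Rightarrow> complex) set" where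
  "gauss_dom C g \<omega> 0 = sym2 g"
| "gauss_dom C g \<omega> (Suc k) = {a \<in> gauss_dom C g \<omega> k. gauss_map C g \<omega> (2 * k) a = 0}"

text \<open>The kernel of \<open>\<mu>\<^sub>m\<close>, for even \<open>m \<ge> -2\<close>; the kernel of \<open>\<mu>\<^sub>-\<^sub>2\<close> is the full symmetric square.\<close>

definition gauss_ker ::
    "'n::finite pt set \<Rightarrow> nat \<Rightarrow> (nat \<Rightarrow> 'n form) \<Rightarrow> int \<Rightarrow> (nat \<Rightarrow> nat \<Rightarrow> complex) set" where
  "gauss_ker C g \<omega> m = gauss_dom C g \<omega> (nat ((m + 2) div 2))"

definition gauss_rank :: "'n::finite pt set \<Rightarrow> nat \<Rightarrow> (nat \<Rightarrow> 'n form) \<Rightarrow> nat \<Rightarrow> nat" where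
  "gauss_rank C g \<omega> m = fvec.dim (gauss_map C g \<omega> m ` gauss_ker C g \<omega> (int m - 2))"

end

theory Submission
  imports Defs
begin

text \<open>An element of \<open>ker \<mu>\<^sub>2\<^sub>k\<^sub>-\<^sub>2\<close> is a symmetric section of \<open>K \<boxtimes> K\<close> on \<open>C \<times> C\<close> that vanishes to order
  \<open>2 k\<close> along the diagonal. So its restriction to \<open>C \<times> {y}\<close> is a differential vanishing to order
  \<open>2 k\<close> at \<open>y\<close>. At a general point \<open>y\<close> no nonzero differential vanishes to order \<open>g\<close>, because the
  Wronskian of a basis of differentials is not identically zero. Hence \<open>ker \<mu>\<^sub>2\<^sub>k\<^sub>-\<^sub>2 = 0\<close> as soon as
  \<open>2 k \<ge> g\<close> (lemma \<open>gauss_dom_trivial\<close>), well before \<open>k = 3 g - 2\<close>.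

  This settles the dimension bounds as well. With \<open>k = 3 g - 3 - l\<close>, either \<open>2 k \<ge> g\<close> and the kernel
  is zero, or \<open>2 (l + 1) \<ge> 5 g - 3 \<ge> 2 g\<close>, so that \<open>(l + 1)\<^sup>2\<close> is at least \<open>g\<^sup>2\<close>, which bounds the
  dimension of the space of all symmetric \<open>g \<times> g\<close> matrices.

  The argument has three ingredients: the Wronskian-type statement \<open>wronskian_vanishing\<close>, the passage
  from the vanishing of the even derivatives along the diagonal to all derivatives of low order
  (\<open>jet_pairing_vanishing\<close>), and the identity theorem for differentials on the connected curve
  (\<open>form_eq_0_if_locally_0\<close>), which keeps the basis linearly independent near any given point.\<close>

section \<open>A Wronskian argument\<close>

text \<open>This is the statement that the Wronskian of linearly independent holomorphic functions \<open>v i\<close> does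
  not vanish identically, in the form needed for the kernels: there the \<open>u i\<close> are combinations of the
  \<open>v i\<close> themselves. Letting \<open>t\<close> vary over a connected set gives an induction without determinants.
  Dividing the relations by the last \<open>v\<close> makes its coefficient constant; differentiating and subtracting
  the next relation then removes one summand at the cost of one relation, and the functions
  \<open>(v i / v r)'\<close> that take the place of the \<open>v i\<close> are again linearly independent.\<close>

lemma wronskian_vanishing:
  fixes u v :: "nat \<Rightarrow> complex \<Rightarrow> complex"
  assumes "open W" "connected W" "W \<noteq> {}"
    and "\<And>i. i < r \<Longrightarrow> u i holomorphic_on W"
    and "\<And>i. i < r \<Longrightarrow> v i holomorphic_on W"
    and "\<And>c. \<forall>t\<in>W. (\<Sum>i<r. c i * v i t) = 0 \<Longrightarrow> \<forall>i<r. c i = 0"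
    and "\<And>m t. m < r \<Longrightarrow> t \<in> W \<Longrightarrow> (\<Sum>i<r. (deriv ^^ m) (u i) t * v i t) = 0"
    and "i < r" "t \<in> W"
  shows "u i t = 0"
  using assms
proof (induction r arbitrary: v W i t)
  case 0
  then show ?case by simp
next
  case (Suc r)
  note W = Suc.prems(1-3) and holu = Suc.prems(4) and holv = Suc.prems(5)
    and indep = Suc.prems(6) and van = Suc.prems(7)
  \<comment> \<open>The induction continues on a disc where the divisor \<open>v r\<close> has no zero.\<close>
  have "\<exists>t0\<in>W. v r t0 \<noteq> 0"
  proof (rule ccontr)
    assume "\<not> ?thesis"
    then have "\<forall>t\<in>W. (\<Sum>i<Suc r. (if i = r then 1 else 0) * v i t) = 0" by simp
    from indep[OF this] show False by auto
  qed
  then obtain t0 where t0: "t0 \<in> W" "v r t0 \<noteq> 0" by blast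
  have "continuous_on W (v r)" using holv by (simp add: holomorphic_on_imp_continuous_on)
  then have "open (W \<inter> v r -` (- {0}))"
    using W(1) by (intro continuous_open_preimage) auto
  then obtain e where e: "e > 0" "ball t0 e \<subseteq> W \<inter> v r -` (- {0})"
    using t0 by (metis IntI ComplI open_contains_ball singletonD vimageI)
  define B where "B = ball t0 e"
  have B: "open B" "connected B" "B \<noteq> {}" "B \<subseteq> W" and nz: "\<And>t. t \<in> B \<Longrightarrow> v r t \<noteq> 0"
    using e by (auto simp: B_def)
  define w where "w i t = v i t / v r t" for i t
  have holw: "w i holomorphic_on B" if "i < Suc r" for i
    unfolding w_def[abs_def]
    using holv[OF that] holv[of r] nz B(4) by (auto intro!: holomorphic_intros intro: holomorphic_on_subset)
  have holuB: "u i holomorphic_on B" if "i < Suc r" for i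
    using holu[OF that] B(4) holomorphic_on_subset by blast
  have holuD: "(deriv ^^ m) (u i) holomorphic_on B" if "i < Suc r" for i m
    using holuB[OF that] B(1) by (rule holomorphic_higher_deriv)
  have rel: "(\<Sum>i<r. (deriv ^^ m) (u i) t * w i t) + (deriv ^^ m) (u r) t = 0"
    if "m < Suc r" "t \<in> B" for m t
  proof -
    have "(\<Sum>i<Suc r. (deriv ^^ m) (u i) t * v i t) / v r t = 0"
      using van[OF that(1)] that(2) B(4) by auto
    then show ?thesis using nz[OF that(2)]
      by (simp add: w_def add_divide_distrib sum_divide_distrib)
  qed
  have rel': "(\<Sum>i<r. (deriv ^^ m) (u i) t * deriv (w i) t) = 0" if m: "m < r" and t: "t \<in> B" for m t
  proof -
    let ?S = "\<lambda>t. (\<Sum>i<r. (deriv ^^ m) (u i) t * w i t) + (deriv ^^ m) (u r) t"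
    have du: "((deriv ^^ m) (u i) has_field_derivative (deriv ^^ Suc m) (u i) t) (at t)"
      if "i < Suc r" for i
      using holomorphic_derivI[OF holuD[OF that] B(1) t] by simp
    have dw: "(w i has_field_derivative deriv (w i) t) (at t)" if "i < Suc r" for i
      using holomorphic_derivI[OF holw[OF that] B(1) t] .
    have "(?S has_field_derivative
        (\<Sum>i<r. (deriv ^^ Suc m) (u i) t * w i t + (deriv ^^ m) (u i) t * deriv (w i) t)
          + (deriv ^^ Suc m) (u r) t) (at t)"
      by (intro DERIV_add DERIV_sum du)
        (auto intro!: derivative_eq_intros du dw simp del: funpow.simps)
    moreover have "(?S has_field_derivative 0) (at t)"
      by (rule has_field_derivative_transform_within_open[where f="\<lambda>_. 0" and S=B])
        (use rel m t B in auto)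
    ultimately have "(\<Sum>i<r. (deriv ^^ Suc m) (u i) t * w i t + (deriv ^^ m) (u i) t * deriv (w i) t)
          + (deriv ^^ Suc m) (u r) t = 0"
      by (rule DERIV_unique)
    moreover have "y = 0" if "x + y + z = 0" "x + z = 0" for x y z :: complex
      using that by algebra
    ultimately show ?thesis using rel[of "Suc m" t] m t by (simp only: sum.distrib Suc_less_eq)
  qed
  have indep': "\<forall>i<r. c i = 0" if c: "\<forall>t\<in>B. (\<Sum>i<r. c i * deriv (w i) t) = 0" for c
  proof -
    let ?T = "\<lambda>t. \<Sum>i<r. c i * w i t"
    have "(?T has_field_derivative 0) (at t within B)" if t: "t \<in> B" for t
    proof -
      have "(?T has_field_derivative (\<Sum>i<r. c i * deriv (w i) t)) (at t)"
        by (intro DERIV_sum DERIV_cmult) (use holomorphic_derivI[OF holw B(1) t] in auto)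
      with c t show ?thesis by (metis has_field_derivative_at_within)
    qed
    then have "\<exists>k. \<forall>t\<in>B. ?T t = k"
      unfolding B_def by (intro has_field_derivative_zero_constant convex_ball)
    then obtain k where k: "\<And>t. t \<in> B \<Longrightarrow> ?T t = k" by blast
    \<comment> \<open>The combination of the \<open>w i\<close> is a constant \<open>k\<close>; multiplied by \<open>v r\<close> this is a relation between
      \<open>v 0, \<dots>, v r\<close>.\<close>
    let ?d = "\<lambda>i. if i = r then - k else c i"
    have "(\<Sum>i<Suc r. ?d i * v i t) = 0" if "t \<in> B" for t
    proof -
      have "(\<Sum>i<Suc r. ?d i * v i t) = (\<Sum>i<r. c i * v i t) - k * v r t" by simp
      also have "(\<Sum>i<r. c i * v i t) = ?T t * v r t"
        using nz[OF that] by (simp add: w_def sum_distrib_right)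
      finally show ?thesis using k[OF that] by simp
    qed
    moreover have "(\<lambda>t. \<Sum>i<Suc r. ?d i * v i t) holomorphic_on W"
      using holv by (intro holomorphic_intros) auto
    ultimately have "(\<Sum>i<Suc r. ?d i * v i t) = 0" if "t \<in> W" for t
      using analytic_continuation_open[OF B(1) W(1) B(3) W(2) B(4) _ holomorphic_on_const _ that]
      by blast
    then have "\<forall>i<Suc r. ?d i = 0" by (intro indep) blast
    then have "?d i = 0" if "i < r" for i using that less_SucI by blast
    then show ?thesis by (auto split: if_splits)
  qed
  have u0: "u i t = 0" if "i < r" "t \<in> B" for i t
    by (rule Suc.IH[where v="\<lambda>i. deriv (w i)", OF B(1-3) _ _ indep' rel' that])
      (auto intro: holuB holomorphic_deriv[OF holw B(1)])
  have "u i t = 0" if "t \<in> B" "i < Suc r" for i t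
    using rel[of 0 t] u0 that by (cases "i = r") auto
  then show ?case
    using analytic_continuation_open[OF B(1) W(1) B(3) W(2) B(4) holu[OF Suc.prems(8)]
        holomorphic_on_const _ Suc.prems(9)] Suc.prems(8) by blast
qed

section \<open>Vanishing along the diagonal\<close>

definition jet_pairing ::
    "nat \<Rightarrow> (nat \<Rightarrow> nat \<Rightarrow> complex) \<Rightarrow> (nat \<Rightarrow> complex \<Rightarrow> complex) \<Rightarrow> nat \<Rightarrow> nat \<Rightarrow> complex \<Rightarrow> complex" where
  "jet_pairing g a f p q t = (\<Sum>i<g. \<Sum>j<g. a i j * (deriv ^^ p) (f i) t * (deriv ^^ q) (f j) t)"

lemma jet_pairing_commute:
  assumes "\<And>i j. a i j = a j i"
  shows "jet_pairing g a f p q t = jet_pairing g a f q p t"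
proof -
  have "jet_pairing g a f p q t = (\<Sum>j<g. \<Sum>i<g. a i j * (deriv ^^ p) (f i) t * (deriv ^^ q) (f j) t)"
    unfolding jet_pairing_def by (rule sum.swap)
  also have "\<dots> = jet_pairing g a f q p t"
    unfolding jet_pairing_def by (intro sum.cong refl) (simp add: assms[of i j for i j] mult_ac)
  finally show ?thesis .
qed

lemma has_field_derivative_jet_pairing:
  assumes "open W" "\<And>i. i < g \<Longrightarrow> f i holomorphic_on W" "t \<in> W"
  shows "(jet_pairing g a f p q has_field_derivative
           jet_pairing g a f (Suc p) q t + jet_pairing g a f p (Suc q) t) (at t)"
proof -
  have d: "((deriv ^^ m) (f i) has_field_derivative (deriv ^^ Suc m) (f i) t) (at t)" if "i < g" for i m
    using holomorphic_derivI[OF holomorphic_higher_deriv[OF assms(2)[OF that] assms(1)] assms(1,3)] by simp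
  have "((\<lambda>t. \<Sum>i<g. \<Sum>j<g. a i j * (deriv ^^ p) (f i) t * (deriv ^^ q) (f j) t) has_field_derivative
     (\<Sum>i<g. \<Sum>j<g. a i j * (deriv ^^ Suc p) (f i) t * (deriv ^^ q) (f j) t
                 + a i j * (deriv ^^ p) (f i) t * (deriv ^^ Suc q) (f j) t)) (at t)"
    by (intro DERIV_sum) (auto intro!: derivative_eq_intros d simp del: funpow.simps)
  then show ?thesis unfolding jet_pairing_def[abs_def] by (simp add: sum.distrib)
qed

text \<open>Once the pairings of total order \<open>n - 1\<close> vanish, their derivatives show that those of total
  order \<open>n\<close> agree up to the sign \<open>(-1) ^ q\<close>. For odd \<open>n\<close> symmetry then forces them to vanish, so that only the
  even orders are conditions.\<close>

lemma jet_pairing_vanishing: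
  assumes W: "open W" and hol: "\<And>i. i < g \<Longrightarrow> f i holomorphic_on W"
    and sym: "\<And>i j. a i j = a j i"
    and even: "\<And>k t. k < K \<Longrightarrow> t \<in> W \<Longrightarrow> jet_pairing g a f (2 * k) 0 t = 0"
    and "p + q < 2 * K" "t \<in> W"
  shows "jet_pairing g a f p q t = 0"
  using assms(5,6)
proof (induction "p + q" arbitrary: p q t rule: less_induct)
  case less
  define n where "n = p + q"
  have shift: "jet_pairing g a f p' (Suc q') t = - jet_pairing g a f (Suc p') q' t"
    if "Suc (p' + q') = n" for p' q'
  proof -
    have "jet_pairing g a f p' q' s = 0" if "s \<in> W" for s
      using less.hyps[of p' q' s] less.prems that \<open>Suc (p' + q') = n\<close> by (simp add: n_def)
    then have "(jet_pairing g a f p' q' has_field_derivative 0) (at t)"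
      by - (rule has_field_derivative_transform_within_open[where f="\<lambda>_. 0" and S=W],
          use W less.prems in auto)
    from DERIV_unique[OF this has_field_derivative_jet_pairing[where a=a, OF W hol less.prems(2)]]
    show ?thesis by (simp add: add_eq_0_iff)
  qed
  have sign: "jet_pairing g a f (n - q') q' t = (-1) ^ q' * jet_pairing g a f n 0 t" if "q' \<le> n" for q'
    using that
  proof (induction q')
    case (Suc q')
    then show ?case using shift[of "n - Suc q'" q'] by (simp add: Suc_diff_Suc)
  qed simp
  have "jet_pairing g a f n 0 t = 0"
  proof (cases "even n")
    case True
    then obtain k where "n = 2 * k" by blast
    then show ?thesis using even[of k t] less.prems by (simp add: n_def)
  next
    case False
    then show ?thesis using sign[of n] jet_pairing_commute[where a=a and g=g and f=f and p=0 and q=n and t=t, OF sym] by simp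
  qed
  then show ?case using sign[of q] by (simp add: n_def)
qed

section \<open>The identity theorem for differentials\<close>

definition vanishes_near :: "'n::finite pt set \<Rightarrow> 'n form \<Rightarrow> 'n pt \<Rightarrow> bool" where
  "vanishes_near C f p \<longleftrightarrow>
     (\<exists>U z S. local_coord C (U, z) \<and> p \<in> U \<and> open S \<and> z p \<in> S \<and> S \<subseteq> z ` U \<and> (\<forall>s\<in>S. f (U, z) s = 0))"

lemma local_coord_subset:
  assumes "local_coord C (U, z)"
  shows "U \<subseteq> C"
  using assms by (auto simp: local_coord_def openin_subtopology)

lemma openin_coord_preimage:
  assumes U: "local_coord C (U, z)" and S: "open S"
  shows "openin (subtopology proj_top C) {p \<in> U. z p \<in> S}"
proof -
  have op: "openin (subtopology proj_top C) U"
    and hom: "homeomorphic_map (subtopology proj_top U) (top_of_set (z ` U)) z"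
    using U by (auto simp: local_coord_def)
  have UT: "U \<subseteq> topspace proj_top" using openin_subset[OF op] by auto
  have "openin (top_of_set (z ` U)) (z ` U \<inter> S)"
    using S by (simp add: openin_open_Int)
  with homeomorphic_imp_continuous_map[OF hom]
  have "openin (subtopology proj_top U) {p \<in> topspace (subtopology proj_top U). z p \<in> z ` U \<inter> S}"
    by (rule openin_continuous_map_preimage)
  moreover have "{p \<in> topspace (subtopology proj_top U). z p \<in> z ` U \<inter> S} = {p \<in> U. z p \<in> S}"
    using UT by auto
  moreover have "subtopology proj_top U = subtopology (subtopology proj_top C) U"
    using local_coord_subset[OF U] by (simp add: subtopology_subtopology Int_absorb1)
  ultimately show ?thesis using op by (metis openin_trans_full)
qed

lemma open_coord_image:
  assumes U: "local_coord C (U, z)" and P: "openin (subtopology proj_top C) P" "P \<subseteq> U"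
  shows "open (z ` P)"
proof -
  have op: "open (z ` U)"
    and hom: "homeomorphic_map (subtopology proj_top U) (top_of_set (z ` U)) z"
    using U by (auto simp: local_coord_def)
  obtain T where T: "openin proj_top T" "P = T \<inter> C"
    using P(1) by (auto simp: openin_subtopology)
  then have "P = T \<inter> U" using P(2) local_coord_subset[OF U] by blast
  with T have "openin (subtopology proj_top U) P" by (auto simp: openin_subtopology)
  then have "openin (top_of_set (z ` U)) (z ` P)"
    using hom homeomorphic_imp_open_map open_map_def by blast
  then show ?thesis using op openin_open_trans by blast
qed

lemma form_eq_0_change_coord:
  assumes "f \<in> holomorphic_forms C" "local_coord C (U, z)" "local_coord C (V, w)" "p \<in> U" "p \<in> V"
    "f (V, w) (w p) = 0"
  shows "f (U, z) (z p) = 0"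
proof -
  have "f (U, z) (z p) = f (V, w) (w p) * deriv (w \<circ> inv_into U z) (z p)"
    using assms unfolding holomorphic_forms_def by blast
  with assms(6) show ?thesis by simp
qed

lemma openin_vanishes_near:
  "openin (subtopology proj_top C) {p \<in> C. vanishes_near C f p}"
proof (subst openin_subopen, intro ballI)
  fix p assume "p \<in> {p \<in> C. vanishes_near C f p}"
  then obtain U z S where U: "local_coord C (U, z)" "p \<in> U" "open S" "z p \<in> S" "S \<subseteq> z ` U"
      "\<forall>s\<in>S. f (U, z) s = 0"
    by (auto simp: vanishes_near_def)
  have "vanishes_near C f q" if "q \<in> U" "z q \<in> S" for q
    unfolding vanishes_near_def using U that by blast
  then have "{p \<in> U. z p \<in> S} \<subseteq> {p \<in> C. vanishes_near C f p}"
    using local_coord_subset[OF U(1)] by auto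
  then show "\<exists>T. openin (subtopology proj_top C) T \<and> p \<in> T \<and> T \<subseteq> {p \<in> C. vanishes_near C f p}"
    using openin_coord_preimage[OF U(1,3)] U(2,4) by blast
qed

text \<open>By the identity theorem on a coordinate disc around \<open>p\<close>, vanishing near one point of the disc
  propagates to the whole disc, hence to \<open>p\<close>.\<close>

lemma openin_not_vanishes_near:
  assumes C: "smooth_projective_curve C" and f: "f \<in> holomorphic_forms C"
  shows "openin (subtopology proj_top C) {p \<in> C. \<not> vanishes_near C f p}"
proof (subst openin_subopen, intro ballI)
  fix p assume p: "p \<in> {p \<in> C. \<not> vanishes_near C f p}"
  then obtain U z where U: "local_coord C (U, z)" "p \<in> U"
    using C unfolding smooth_projective_curve_def by blast
  have "open (z ` U)" using U by (simp add: local_coord_def)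
  then obtain e where e: "e > 0" "ball (z p) e \<subseteq> z ` U"
    using U(2) by (metis imageI open_contains_ball)
  define B where "B = ball (z p) e"
  have B: "open B" "connected B" "z p \<in> B" "B \<subseteq> z ` U" using e by (auto simp: B_def)
  have hol: "f (U, z) holomorphic_on B"
    using f U(1) B(4) holomorphic_on_subset unfolding holomorphic_forms_def by blast
  have "\<not> vanishes_near C f q" if q: "q \<in> U" "z q \<in> B" for q
  proof
    assume "vanishes_near C f q"
    then obtain V w S where V: "local_coord C (V, w)" "q \<in> V" "open S" "w q \<in> S" "S \<subseteq> w ` V"
        "\<forall>s\<in>S. f (V, w) s = 0"
      by (auto simp: vanishes_near_def)
    define P where "P = {x \<in> U. z x \<in> B} \<inter> {x \<in> V. w x \<in> S}"
    have "openin (subtopology proj_top C) P"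
      unfolding P_def using openin_coord_preimage U(1) V(1,3) B(1) by blast
    then have "open (z ` P)" by (rule open_coord_image[OF U(1)]) (auto simp: P_def)
    moreover have "z ` P \<noteq> {}" "z ` P \<subseteq> B" using q V by (auto simp: P_def)
    moreover have "f (U, z) s = 0" if "s \<in> z ` P" for s
      using that form_eq_0_change_coord[OF f U(1) V(1)] V(6) by (auto simp: P_def)
    ultimately have "f (U, z) s = 0" if "s \<in> B" for s
      using analytic_continuation_open[OF _ B(1) _ B(2) _ hol holomorphic_on_const _ that] by blast
    then have "vanishes_near C f p" using U B unfolding vanishes_near_def by blast
    with p show False by simp
  qed
  then have "{x \<in> U. z x \<in> B} \<subseteq> {p \<in> C. \<not> vanishes_near C f p}"
    using local_coord_subset[OF U(1)] by auto
  then show "\<exists>T. openin (subtopology proj_top C) T \<and> p \<in> T \<and> T \<subseteq> {p \<in> C. \<not> vanishes_near C f p}"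
    using openin_coord_preimage[OF U(1) B(1)] U(2) B(3) by blast
qed

lemma form_eq_0_if_locally_0:
  assumes C: "smooth_projective_curve C" and f: "f \<in> holomorphic_forms C"
    and p: "p \<in> C" "vanishes_near C f p"
  shows "f = 0"
proof -
  have "connected_space (subtopology proj_top C)" "C \<subseteq> topspace proj_top"
    using C by (auto simp: smooth_projective_curve_def connectedin_def)
  moreover have "{p \<in> C. vanishes_near C f p} \<union> {p \<in> C. \<not> vanishes_near C f p} = C" by auto
  moreover have "{p \<in> C. vanishes_near C f p} \<noteq> {}" using p by auto
  ultimately have "{p \<in> C. \<not> vanishes_near C f p} = {}"
    using openin_vanishes_near[of C f] openin_not_vanishes_near[OF C f]
    unfolding connected_space_def
    by (smt (verit, ccfv_threshold) disjoint_iff mem_Collect_eq topspace_subtopology_subset subset_eq)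
  then have van: "vanishes_near C f x" if "x \<in> C" for x using that by blast
  have "f (U, z) t = 0" for U z t
  proof (cases "local_coord C (U, z) \<and> t \<in> z ` U")
    case True
    then obtain x where x: "x \<in> U" "t = z x" by blast
    then have "vanishes_near C f x" using van True local_coord_subset by blast
    then obtain V w where V: "local_coord C (V, w)" "x \<in> V" "f (V, w) (w x) = 0"
      unfolding vanishes_near_def by blast
    show ?thesis
      using form_eq_0_change_coord[OF f _ V(1) x(1) V(2,3)] True x(2) by simp
  next
    case False
    then show ?thesis using f unfolding holomorphic_forms_def by blast
  qed
  then show ?thesis by (auto simp: fun_eq_iff)
qed

section \<open>The kernels\<close>

lemma sum_fun_apply2: "(\<Sum>i\<in>A. f i) x y = (\<Sum>i\<in>A. f i x y)"
  for f :: "'a \<Rightarrow> 'b \<Rightarrow> 'c \<Rightarrow> complex"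
  by (induction A rule: infinite_finite_induct) auto

text \<open>A linear relation on an open piece of one chart is a differential that vanishes there, hence
  everywhere, so it is a relation between the basis differentials.\<close>

lemma basis_locally_independent:
  assumes C: "smooth_projective_curve C" and b: "basis_of_forms C g \<omega>"
    and U: "local_coord C (U, z)" and W: "open W" "W \<noteq> {}" "W \<subseteq> z ` U"
    and c: "\<forall>t\<in>W. (\<Sum>i<g. c i * \<omega> i (U, z) t) = 0"
  shows "\<forall>i<g. c i = 0"
proof -
  define f where "f = (\<Sum>i<g. fscale (c i) (\<omega> i))"
  have "f \<in> fvec.span (\<omega> ` {..<g})"
    unfolding f_def by (intro fvec.span_sum fvec.span_scale fvec.span_base) auto
  then have f: "f \<in> holomorphic_forms C" using b by (simp add: basis_of_forms_def)
  obtain p where p: "p \<in> U" "z p \<in> W" using W by blast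
  have "\<forall>t\<in>W. f (U, z) t = 0"
    using c by (simp add: f_def sum_fun_apply2 fscale_def)
  then have "vanishes_near C f p" using p U W unfolding vanishes_near_def by blast
  then have "f = 0" using form_eq_0_if_locally_0[OF C f] p local_coord_subset[OF U] by blast
  have inj: "inj_on \<omega> {..<g}" and ind: "fvec.independent (\<omega> ` {..<g})"
    using b by (auto simp: basis_of_forms_def)
  define d where "d x = c (the_inv_into {..<g} \<omega> x)" for x
  have "(\<Sum>x\<in>\<omega> ` {..<g}. fscale (d x) x) = f"
    unfolding f_def d_def
    by (subst sum.reindex[OF inj]) (auto intro!: sum.cong simp: the_inv_into_f_f[OF inj])
  with \<open>f = 0\<close> have "d (\<omega> i) = 0" if "i < g" for i
    using fvec.independentD[OF ind _ order.refl] that by blast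
  then show ?thesis by (simp add: d_def the_inv_into_f_f[OF inj])
qed

lemma gauss_dom_subset_sym2: "gauss_dom C g \<omega> k \<subseteq> sym2 g"
  by (induction k) auto

lemma gauss_map_eq_0_if_in_gauss_dom:
  assumes "a \<in> gauss_dom C g \<omega> K" "k < K"
  shows "gauss_map C g \<omega> (2 * k) a = 0"
  using assms
proof (induction K)
  case (Suc K)
  then show ?case unfolding gauss_dom.simps by (cases "k = K") auto
qed simp

lemma gauss_map_0: "gauss_map C g \<omega> m 0 = 0"
  by (auto simp: gauss_map_def fun_eq_iff)

lemma zero_in_gauss_dom: "0 \<in> gauss_dom C g \<omega> k"
proof (induction k)
  case (Suc k)
  then show ?case unfolding gauss_dom.simps using gauss_map_0 by blast
qed (simp add: sym2_def)

text \<open>In a coordinate disc, with \<open>f i\<close> the coefficient of \<open>\<omega> i\<close>, the relations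
  \<open>(\<Sum>i j. a i j * (deriv ^^ m) (f i) t * f j t) = 0\<close> hold for all \<open>m < g\<close>. The Wronskian argument, applied
  to \<open>v j = f j\<close> and \<open>u j = (\<Sum>i. a i j * f i)\<close>, shows that every \<open>u j\<close> is zero, so \<open>a = 0\<close> by
  independence.\<close>

lemma gauss_dom_trivial:
  assumes C: "smooth_projective_curve C" and b: "basis_of_forms C g \<omega>" and k: "g \<le> 2 * k"
  shows "gauss_dom C g \<omega> k = {0}"
proof -
  have "a = 0" if a: "a \<in> gauss_dom C g \<omega> k" for a
  proof -
    have sym: "\<And>i j. a i j = a j i" and ext: "\<And>i j. \<not> (i < g \<and> j < g) \<Longrightarrow> a i j = 0"
      using a gauss_dom_subset_sym2 unfolding sym2_def by blast+
    obtain p U z where U: "local_coord C (U, z)" "p \<in> U"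
      using C unfolding smooth_projective_curve_def by blast
    then have "open (z ` U)" by (simp add: local_coord_def)
    then obtain e where e: "e > 0" "ball (z p) e \<subseteq> z ` U"
      using U(2) by (metis imageI open_contains_ball)
    define W where "W = ball (z p) e"
    have W: "open W" "connected W" "W \<noteq> {}" "W \<subseteq> z ` U" using e by (auto simp: W_def)
    define f where "f i = \<omega> i (U, z)" for i
    have hol: "f i holomorphic_on W" if "i < g" for i
    proof -
      have "\<omega> i \<in> holomorphic_forms C"
        using b that fvec.span_base[of "\<omega> i" "\<omega> ` {..<g}"] by (auto simp: basis_of_forms_def)
      then show ?thesis
        using U(1) W(4) holomorphic_on_subset unfolding holomorphic_forms_def f_def by blast
    qed
    have indep: "\<forall>i<g. c i = 0" if "\<forall>t\<in>W. (\<Sum>i<g. c i * f i t) = 0" for c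
      using basis_locally_independent[OF C b U(1) W(1,3,4)] that by (simp add: f_def)
    have ev: "jet_pairing g a f (2 * j) 0 t = 0" if "j < k" "t \<in> W" for j t
    proof -
      have "gauss_map C g \<omega> (2 * j) a (U, z) t = 0"
        using gauss_map_eq_0_if_in_gauss_dom[OF a that(1)] by simp
      moreover have "t \<in> z ` U" using W(4) that(2) by blast
      ultimately show ?thesis
        using U(1) by (simp add: gauss_map_def jet_pairing_def f_def)
    qed
    define u where "u j t = (\<Sum>i<g. a i j * f i t)" for j t
    have holu: "u j holomorphic_on W" for j
      unfolding u_def[abs_def] using hol by (intro holomorphic_intros) auto
    have du: "(deriv ^^ m) (u j) t = (\<Sum>i<g. a i j * (deriv ^^ m) (f i) t)" if "t \<in> W" for m j t
      using that
    proof (induction m arbitrary: t)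
      case 0
      then show ?case by (simp add: u_def)
    next
      case (Suc m)
      have "((\<lambda>t. \<Sum>i<g. a i j * (deriv ^^ m) (f i) t) has_field_derivative
              (\<Sum>i<g. a i j * (deriv ^^ Suc m) (f i) t)) (at t)"
        using holomorphic_derivI[OF holomorphic_higher_deriv[OF hol W(1)] W(1) Suc.prems]
        by (intro DERIV_sum DERIV_cmult) auto
      then have "((deriv ^^ m) (u j) has_field_derivative
              (\<Sum>i<g. a i j * (deriv ^^ Suc m) (f i) t)) (at t)"
        by (rule has_field_derivative_transform_within_open[OF _ W(1) Suc.prems]) (simp add: Suc.IH)
      then show ?case by (simp add: DERIV_imp_deriv)
    qed
    have van: "(\<Sum>j<g. (deriv ^^ m) (u j) t * f j t) = 0" if "m < g" "t \<in> W" for m t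
    proof -
      have "(\<Sum>j<g. (deriv ^^ m) (u j) t * f j t) = (\<Sum>j<g. \<Sum>i<g. a i j * (deriv ^^ m) (f i) t * f j t)"
        using that(2) by (simp add: du sum_distrib_right)
      also have "\<dots> = jet_pairing g a f m 0 t"
        unfolding jet_pairing_def by (subst sum.swap) simp
      also have "\<dots> = 0"
        using jet_pairing_vanishing[where a=a and f=f, OF W(1) hol sym ev] that k by simp
      finally show ?thesis .
    qed
    have u0: "u j t = 0" if "j < g" "t \<in> W" for j t
      using wronskian_vanishing[OF W(1-3) holu hol indep van that] .
    have "a i j = 0" for i j
    proof (cases "i < g \<and> j < g")
      case True
      then have "\<forall>i<g. a i j = 0" using u0 by (intro indep) (simp add: u_def)
      with True show ?thesis by blast
    qed (rule ext)
    then show "a = 0" by (auto simp: fun_eq_iff)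
  qed
  then show ?thesis using zero_in_gauss_dom by blast
qed

section \<open>Dimension bounds\<close>

definition matrix_unit :: "nat \<times> nat \<Rightarrow> nat \<Rightarrow> nat \<Rightarrow> complex" where
  "matrix_unit q = (\<lambda>i j. if (i, j) = q then 1 else 0)"

lemma sym2_subset_span: "sym2 g \<subseteq> fvec.span (matrix_unit ` ({..<g} \<times> {..<g}))"
proof
  fix a assume a: "a \<in> sym2 g"
  have "a = (\<Sum>q\<in>{..<g} \<times> {..<g}. fscale (a (fst q) (snd q)) (matrix_unit q))"
  proof (intro ext)
    fix i j
    have "(\<Sum>q\<in>{..<g} \<times> {..<g}. fscale (a (fst q) (snd q)) (matrix_unit q)) i j
        = (\<Sum>q\<in>{..<g} \<times> {..<g}. if q = (i, j) then a i j else 0)"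
      unfolding sum_fun_apply2 fscale_def matrix_unit_def by (intro sum.cong) auto
    also have "\<dots> = a i j" using a by (auto simp: sym2_def)
    finally show "a i j = (\<Sum>q\<in>{..<g} \<times> {..<g}. fscale (a (fst q) (snd q)) (matrix_unit q)) i j" ..
  qed
  moreover have "\<dots> \<in> fvec.span (matrix_unit ` ({..<g} \<times> {..<g}))"
    by (intro fvec.span_sum fvec.span_scale fvec.span_base) auto
  ultimately show "a \<in> fvec.span (matrix_unit ` ({..<g} \<times> {..<g}))" by simp
qed

lemma dim_zero: "fvec.dim {0} = 0"
  using fvec.dim_le_card[of "{0}" "{}"] by simp

lemma card_matrix_units: "card (matrix_unit ` ({..<g} \<times> {..<g})) \<le> g\<^sup>2"
  using card_image_le[of "{..<g} \<times> {..<g}" matrix_unit] by (simp add: power2_eq_square)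

lemma dim_subset_sym2:
  assumes "A \<subseteq> sym2 g"
  shows "fvec.dim A \<le> g\<^sup>2"
proof -
  have "fvec.dim A \<le> card (matrix_unit ` ({..<g} \<times> {..<g}))"
    using assms sym2_subset_span by (intro fvec.dim_le_card) auto
  then show ?thesis using card_matrix_units[of g] by (rule order.trans)
qed

lemma linear_gauss_map: "Vector_Spaces.linear fscale fscale (gauss_map C g \<omega> m)"
proof unfold_locales
  fix a b :: "nat \<Rightarrow> nat \<Rightarrow> complex" and c :: complex
  show "gauss_map C g \<omega> m (a + b) = gauss_map C g \<omega> m a + gauss_map C g \<omega> m b"
    by (simp add: gauss_map_def fun_eq_iff distrib_right sum.distrib)
  show "gauss_map C g \<omega> m (fscale c a) = fscale c (gauss_map C g \<omega> m a)"
    by (simp add: gauss_map_def fun_eq_iff fscale_def sum_distrib_left mult.assoc)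
qed

lemma dim_gauss_map_image:
  assumes "A \<subseteq> sym2 g"
  shows "fvec.dim (gauss_map C g \<omega> m ` A) \<le> g\<^sup>2"
proof -
  let ?E = "matrix_unit ` ({..<g} \<times> {..<g})"
  interpret lin: Vector_Spaces.linear fscale fscale "gauss_map C g \<omega> m"
    by (rule linear_gauss_map)
  have "gauss_map C g \<omega> m ` A \<subseteq> fvec.span (gauss_map C g \<omega> m ` ?E)"
    using assms sym2_subset_span lin.span_image by blast
  then have "fvec.dim (gauss_map C g \<omega> m ` A) \<le> card (gauss_map C g \<omega> m ` ?E)"
    by (intro fvec.dim_le_card) auto
  also have "\<dots> \<le> card ?E" by (rule card_image_le) auto
  finally show ?thesis using card_matrix_units[of g] by simp
qed

theorem theorem1p3:
  fixes C :: "'n::finite pt set"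
    and g :: nat
    and \<omega> :: "nat \<Rightarrow> 'n form"
  assumes curve: "smooth_projective_curve C"
    and genus: "genus C = g"
    and genus_ge: "g \<ge> 4"
    and nonhyp: "\<not> hyperelliptic C"
    and basis: "basis_of_forms C g \<omega>"
  shows "gauss_ker C g \<omega> (6 * int g - 6) = {0} \<and>
         (\<forall>k > 3 * g - 3. \<forall>Q \<in> gauss_ker C g \<omega> (2 * int k - 2). gauss_map C g \<omega> (2 * k) Q = 0) \<and>
         (\<forall>l \<le> 3 * g - 3.
            fvec.dim (gauss_ker C g \<omega> (6 * int g - 6 - 2 * (int l + 1))) \<le> (l + 1)^2 \<and>
            gauss_rank C g \<omega> (6 * g - 6 - 2 * l) \<le> (l + 1)^2)"
proof (intro conjI allI impI ballI)
  have "nat ((6 * int g - 6 + 2) div 2) = 3 * g - 2" using genus_ge by linarith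
  then show "gauss_ker C g \<omega> (6 * int g - 6) = {0}"
    using gauss_dom_trivial[OF curve basis, of "3 * g - 2"] genus_ge by (simp add: gauss_ker_def)
next
  fix k Q assume k: "3 * g - 3 < k" and Q: "Q \<in> gauss_ker C g \<omega> (2 * int k - 2)"
  have "gauss_ker C g \<omega> (2 * int k - 2) = {0}"
    using gauss_dom_trivial[OF curve basis, of k] genus_ge k by (simp add: gauss_ker_def)
  with Q show "gauss_map C g \<omega> (2 * k) Q = 0" by (simp add: gauss_map_0)
next
  fix l assume l: "l \<le> 3 * g - 3"
  define k where "k = 3 * g - 3 - l"
  have "nat ((6 * int g - 6 - 2 * (int l + 1) + 2) div 2) = k"
    using genus_ge l unfolding k_def by (simp add: nat_eq_iff2 of_nat_diff)
  then have ker: "gauss_ker C g \<omega> (6 * int g - 6 - 2 * (int l + 1)) = gauss_dom C g \<omega> k"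
    by (simp add: gauss_ker_def)
  have "int (6 * g - 6 - 2 * l) - 2 = 6 * int g - 6 - 2 * (int l + 1)"
    using genus_ge l by (simp add: of_nat_diff)
  then have rank: "gauss_rank C g \<omega> (6 * g - 6 - 2 * l)
      = fvec.dim (gauss_map C g \<omega> (6 * g - 6 - 2 * l) ` gauss_dom C g \<omega> k)"
    by (simp only: gauss_rank_def ker)
  have "fvec.dim (gauss_dom C g \<omega> k) \<le> (l + 1)\<^sup>2 \<and>
        fvec.dim (gauss_map C g \<omega> (6 * g - 6 - 2 * l) ` gauss_dom C g \<omega> k) \<le> (l + 1)\<^sup>2"
  proof (cases "g \<le> 2 * k")
    case True
    then show ?thesis
      by (simp add: gauss_dom_trivial[OF curve basis] gauss_map_0 dim_zero)
  next
    case False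
    then have "g\<^sup>2 \<le> (l + 1)\<^sup>2" using genus_ge l unfolding k_def by (intro power_mono) linarith+
    then show ?thesis
      using dim_subset_sym2[OF gauss_dom_subset_sym2[of C g \<omega> k]]
        dim_gauss_map_image[OF gauss_dom_subset_sym2[of C g \<omega> k], of C \<omega> "6 * g - 6 - 2 * l"]
      by linarith
  qed
  then show "fvec.dim (gauss_ker C g \<omega> (6 * int g - 6 - 2 * (int l + 1))) \<le> (l + 1)\<^sup>2"
    and "gauss_rank C g \<omega> (6 * g - 6 - 2 * l) \<le> (l + 1)\<^sup>2"
    by (simp_all only: ker rank)
qed

end
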